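(* Bounded-error linear-time (linear-space) 2PCAs can recognize uncountably many languages.
   Context: A 2PCA (two--way probabilistic counter automaton) is a two--way probabilistic finite automaton, reading its input placed between a left end-marker and a right end-marker (the dollar sign \$), augmented with a counter: an integer register initially zero whose zero/nonzero status can be read and which can be incremented, decremented, or left unchanged in each step. Transition probabilities may be arbitrary reals. The space used is the maximum counter value. Bounded-error recognition means members are accepted with probability at least $1-\epsilon$ and non-members with probability at most $\epsilon$, for some $\epsilon<1/2$. *)

theory Defs
  imports "HOL-Probability.Probability" "HOL-Library.Landau_Symbols"
begin

datatype 'a tape_symbol = LeftEnd | Input 'a | RightEnd

datatype head_move = MoveLeft | Stay | MoveRight

datatype counter_op = Decrement | Keep | Increment

text \<open>
  The transition of a two-way probabilistic counter automaton depends on the current state, the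
  scanned symbol and whether the counter is zero; it is a probability mass function, so that
  arbitrary real transition probabilities are possible.
\<close>

record ('q, 'a) pca2 =
  states :: "'q set"
  alphabet :: "'a set"
  trans :: "'q \<Rightarrow> 'a tape_symbol \<Rightarrow> bool \<Rightarrow> ('q \<times> head_move \<times> counter_op) pmf"
  start :: 'q
  accept :: 'q
  reject :: 'q

definition tape_symbols :: "('q, 'a) pca2 \<Rightarrow> 'a tape_symbol set" where
  "tape_symbols M = {LeftEnd, RightEnd} \<union> Input ` alphabet M"

text \<open>The last two conditions keep the head between the end-markers.\<close>

definition wf_pca2 :: "('q, 'a) pca2 \<Rightarrow> bool" where
  "wf_pca2 M \<longleftrightarrow>
     finite (states M) \<and> finite (alphabet M) \<and>
     start M \<in> states M \<and> accept M \<in> states M \<and> reject M \<in> states M \<and>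
     accept M \<noteq> reject M \<and>
     (\<forall>q \<in> states M - {accept M, reject M}. \<forall>a \<in> tape_symbols M. \<forall>z.
        \<forall>(q', m, d) \<in> set_pmf (trans M q a z).
          q' \<in> states M \<and>
          (a = LeftEnd \<longrightarrow> m \<noteq> MoveLeft) \<and>
          (a = RightEnd \<longrightarrow> m \<noteq> MoveRight))"

text \<open>
  The input \<open>w\<close> occupies the cells \<open>1, \<dots>, length w\<close>, the end-markers the cells \<open>0\<close> and
  \<open>length w + 1\<close>.
\<close>

definition tape :: "'a list \<Rightarrow> nat \<Rightarrow> 'a tape_symbol" where
  "tape w i =
     (if i = 0 then LeftEnd else if i \<le> length w then Input (w ! (i - 1)) else RightEnd)"

fun move_head :: "head_move \<Rightarrow> nat \<Rightarrow> nat" where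
  "move_head MoveLeft i = i - 1"
| "move_head Stay i = i"
| "move_head MoveRight i = i + 1"

fun update_counter :: "counter_op \<Rightarrow> int \<Rightarrow> int" where
  "update_counter Decrement k = k - 1"
| "update_counter Keep k = k"
| "update_counter Increment k = k + 1"

text \<open>A configuration consists of the state, the head position and the counter value.\<close>

type_synonym 'q config = "'q \<times> nat \<times> int"

definition halted :: "('q, 'a) pca2 \<Rightarrow> 'q config \<Rightarrow> bool" where
  "halted M c \<longleftrightarrow> fst c \<in> {accept M, reject M}"

definition step :: "('q, 'a) pca2 \<Rightarrow> 'a list \<Rightarrow> 'q config \<Rightarrow> 'q config pmf" where
  "step M w c =
     (if halted M c then return_pmf c
      else case c of (q, i, k) \<Rightarrow>
        map_pmf (\<lambda>(q', m, d). (q', move_head m i, update_counter d k))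
          (trans M q (tape w i) (k = 0)))"

text \<open>The distribution of the configuration after \<open>t\<close> steps.\<close>

primrec run :: "('q, 'a) pca2 \<Rightarrow> 'a list \<Rightarrow> nat \<Rightarrow> 'q config pmf" where
  "run M w 0 = return_pmf (start M, 0, 0)"
| "run M w (Suc t) = bind_pmf (run M w t) (step M w)"

text \<open>
  Halted configurations are never left, so the probability of having accepted within \<open>t\<close> steps is
  nondecreasing in \<open>t\<close> and its supremum is the probability of ever accepting.
\<close>

definition accept_prob :: "('q, 'a) pca2 \<Rightarrow> 'a list \<Rightarrow> real" where
  "accept_prob M w = (SUP t. measure_pmf.prob (run M w t) {c. fst c = accept M})"

definition recognizes_with_error :: "('q, 'a) pca2 \<Rightarrow> real \<Rightarrow> 'a list set \<Rightarrow> bool" where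
  "recognizes_with_error M \<epsilon> L \<longleftrightarrow>
     L \<subseteq> lists (alphabet M) \<and>
     (\<forall>w \<in> L. accept_prob M w \<ge> 1 - \<epsilon>) \<and>
     (\<forall>w \<in> lists (alphabet M) - L. accept_prob M w \<le> \<epsilon>)"

definition bounded_error_recognizes :: "('q, 'a) pca2 \<Rightarrow> 'a list set \<Rightarrow> bool" where
  "bounded_error_recognizes M L \<longleftrightarrow>
     (\<exists>\<epsilon>. 0 \<le> \<epsilon> \<and> \<epsilon> < 1 / 2 \<and> recognizes_with_error M \<epsilon> L)"

text \<open>
  Time and space are worst-case: the bounds hold on every input word, member or not, and for every
  computation path of positive probability.  The counter may become negative, so its absolute value
  is what is bounded.
\<close>

definition time_bounded :: "('q, 'a) pca2 \<Rightarrow> (nat \<Rightarrow> nat) \<Rightarrow> bool" where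
  "time_bounded M T \<longleftrightarrow>
     (\<forall>w \<in> lists (alphabet M). \<forall>c \<in> set_pmf (run M w (T (length w))). halted M c)"

definition space_bounded :: "('q, 'a) pca2 \<Rightarrow> (nat \<Rightarrow> nat) \<Rightarrow> bool" where
  "space_bounded M S \<longleftrightarrow>
     (\<forall>w \<in> lists (alphabet M). \<forall>t. \<forall>(q, i, k) \<in> set_pmf (run M w t). \<bar>k\<bar> \<le> int (S (length w)))"

definition linear_time :: "('q, 'a) pca2 \<Rightarrow> bool" where
  "linear_time M \<longleftrightarrow> (\<exists>T. time_bounded M T \<and> (\<lambda>n. real (T n)) \<in> O(\<lambda>n. real n))"

definition linear_space :: "('q, 'a) pca2 \<Rightarrow> bool" where
  "linear_space M \<longleftrightarrow> (\<exists>S. space_bounded M S \<and> (\<lambda>n. real (S n)) \<in> O(\<lambda>n. real n))"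

text \<open>
  Finite state sets and finite alphabets can be taken to consist of natural numbers.  There are only
  countably many finite sets of natural numbers, so an uncountable class of languages cannot result
  from varying the alphabet.
\<close>

definition linear_2PCA_languages :: "nat list set set" where
  "linear_2PCA_languages =
     {L. \<exists>M :: (nat, nat) pca2. wf_pca2 M \<and> linear_time M \<and> linear_space M \<and>
           bounded_error_recognizes M L}"

end

theory Submission
  imports Defs
begin

text \<open>
  Every set \<open>A\<close> of natural numbers gives a real \<open>p\<close> whose base-4 digits lie in \<open>{0,
  1}\<close>, up to the factor 3. A word consists of blocks of lengths \<open>1, 4, 16, \<dots>\<close>; the first
  \<open>j\<close> blocks are blank and the last \<open>j\<close> carry base-4 digits in \<open>{0, 1}\<close>, the
  longest block the most significant one. The word belongs to the language of \<open>A\<close> if the number it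
  carries is at most the \<open>j\<close>-digit prefix given by \<open>A\<close>. In one pass a machine with a coin of
  bias \<open>p\<close> can perform any one of the following tests: the ratio of the lengths in every other pair of
  consecutive blocks; the same for the remaining pairs; the equality of the two numbers of blocks; and a random walk
  whose drift is the toss of the coin minus the digit. As the digits are spaced out in base 4, the expected end point
  of the walk has distance at least \<open>4 ^ j / 6\<close> from 0, on the side that decides membership, while its
  standard deviation is at most \<open>4 ^ j / 12\<close>. The blank blocks shift the threshold into the gap.

  Choosing each of the four tests with probability \<open>1 / 7\<close> and rejecting otherwise yields bounded error
  in a single pass: a member fails only the walk, with probability at most \<open>1 / 4\<close>, hence is accepted
  with probability at least \<open>15 / 28\<close>, while a non-member fails a test with probability at least
  \<open>3 / 4\<close>, hence is accepted with probability at most \<open>13 / 28\<close>.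
\<close>

section \<open>Renaming states and running time\<close>

text \<open>Outside the range of \<open>f\<close> the value of \<open>inv f\<close> is arbitrary,
  but runs of the renamed machine start in that range and stay in it.\<close>

definition relabel :: "('q \<Rightarrow> 'r) \<Rightarrow> ('q, 'a) pca2 \<Rightarrow> ('r, 'a) pca2" where
  "relabel f M = \<lparr>states = f ` states M, alphabet = alphabet M,
     trans = (\<lambda>q a z. map_pmf (apfst f) (trans M (inv f q) a z)),
     start = f (start M), accept = f (accept M), reject = f (reject M)\<rparr>"

lemma relabel_simps [simp]:
  "states (relabel f M) = f ` states M" "alphabet (relabel f M) = alphabet M"
  "trans (relabel f M) q a z = map_pmf (apfst f) (trans M (inv f q) a z)"
  "start (relabel f M) = f (start M)" "accept (relabel f M) = f (accept M)"
  "reject (relabel f M) = f (reject M)"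
  by (simp_all add: relabel_def)

lemma halted_relabel:
  assumes "inj f"
  shows "halted (relabel f M) (apfst f c) = halted M c"
  using assms by (cases c) (auto simp: halted_def dest: injD)

lemma step_relabel:
  assumes "inj f"
  shows "step (relabel f M) w (apfst f c) = map_pmf (apfst f) (step M w c)"
proof (cases "halted M c")
  case True
  then show ?thesis using halted_relabel[OF assms, of M c] by (simp add: step_def)
next
  case False
  then have "\<not> halted (relabel f M) (apfst f c)"
    using halted_relabel[OF assms] by blast
  with False assms show ?thesis
    by (cases c) (auto simp: step_def pmf.map_comp intro!: map_pmf_cong)
qed

lemma run_relabel:
  assumes "inj f"
  shows "run (relabel f M) w t = map_pmf (apfst f) (run M w t)"
proof (induction t)
  case (Suc t)
  then show ?case
    by (simp add: bind_map_pmf map_bind_pmf step_relabel[OF assms])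
qed simp

lemma wf_relabel:
  assumes "inj f" "wf_pca2 M"
  shows "wf_pca2 (relabel f M)"
proof -
  have [simp]: "tape_symbols (relabel f M) = tape_symbols M"
    by (simp add: tape_symbols_def)
  have "case x of (q', m, d) \<Rightarrow> q' \<in> f ` states M \<and> (a = LeftEnd \<longrightarrow> m \<noteq> MoveLeft) \<and>
      (a = RightEnd \<longrightarrow> m \<noteq> MoveRight)"
    if q: "q \<in> f ` states M - {f (accept M), f (reject M)}" and a: "a \<in> tape_symbols M"
      and x: "x \<in> set_pmf (trans (relabel f M) q a z)" for q a x z
  proof -
    obtain r where r: "q = f r" "r \<in> states M - {accept M, reject M}"
      using q by auto
    obtain r' m d where r': "x = (f r', m, d)" "(r', m, d) \<in> set_pmf (trans M r a z)"
      using x r(1) assms(1) by auto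
    have "\<forall>(q', m, d) \<in> set_pmf (trans M r a z).
        q' \<in> states M \<and> (a = LeftEnd \<longrightarrow> m \<noteq> MoveLeft) \<and> (a = RightEnd \<longrightarrow> m \<noteq> MoveRight)"
      using assms(2) r(2) a unfolding wf_pca2_def by blast
    with r' show ?thesis by auto
  qed
  then have "\<forall>q \<in> f ` states M - {f (accept M), f (reject M)}. \<forall>a \<in> tape_symbols M. \<forall>z.
      \<forall>(q', m, d) \<in> set_pmf (trans (relabel f M) q a z).
        q' \<in> f ` states M \<and> (a = LeftEnd \<longrightarrow> m \<noteq> MoveLeft) \<and> (a = RightEnd \<longrightarrow> m \<noteq> MoveRight)"
    by blast
  then show ?thesis
    using assms unfolding wf_pca2_def
    by (simp add: inj_eq del: relabel_simps(3))
qed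

lemma accept_prob_relabel:
  assumes "inj f"
  shows "accept_prob (relabel f M) w = accept_prob M w"
  unfolding accept_prob_def run_relabel[OF assms] measure_map_pmf
  using assms by (intro SUP_cong refl arg_cong2[where f = measure_pmf.prob])
    (auto simp: inj_eq)

lemma recognizes_relabel:
  assumes "inj f"
  shows "bounded_error_recognizes (relabel f M) L = bounded_error_recognizes M L"
  by (simp add: bounded_error_recognizes_def recognizes_with_error_def
      accept_prob_relabel[OF assms])

lemma linear_time_relabel:
  assumes "inj f"
  shows "linear_time (relabel f M) = linear_time M"
  by (simp add: linear_time_def time_bounded_def run_relabel[OF assms] halted_relabel[OF assms])

section \<open>Halting time and counter growth\<close>

lemma run_halted:
  assumes "\<forall>c \<in> set_pmf (run M w t). halted M c"
  shows "run M w (t + s) = run M w t"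
proof (induction s)
  case (Suc s)
  have "bind_pmf (run M w t) (step M w) = bind_pmf (run M w t) return_pmf"
    using assms by (intro bind_pmf_cong) (auto simp: step_def)
  with Suc show ?case by (simp add: bind_return_pmf')
qed simp

lemma counter_le_time:
  assumes "(q, i, k) \<in> set_pmf (run M w t)"
  shows "\<bar>k\<bar> \<le> int t"
  using assms
proof (induction t arbitrary: q i k)
  case (Suc t)
  then obtain c where c: "c \<in> set_pmf (run M w t)" "(q, i, k) \<in> set_pmf (step M w c)"
    by auto
  obtain q0 i0 k0 where c_eq: "c = (q0, i0, k0)" by (cases c)
  have "\<bar>k0\<bar> \<le> int t" using Suc.IH c c_eq by blast
  moreover have "\<bar>k - k0\<bar> \<le> 1"
  proof -
    have "\<bar>update_counter d k0 - k0\<bar> \<le> 1" for d by (cases d) auto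
    then show ?thesis using c c_eq by (auto simp: step_def split: if_splits)
  qed
  ultimately show ?case by linarith
qed simp

text \<open>A step changes the counter by at most one and a halted configuration is frozen, so a
  time bound is itself a space bound.\<close>

lemma linear_time_imp_linear_space:
  assumes "linear_time M"
  shows "linear_space M"
proof -
  obtain T where T: "time_bounded M T" "(\<lambda>n. real (T n)) \<in> O(\<lambda>n. real n)"
    using assms by (auto simp: linear_time_def)
  have "\<bar>k\<bar> \<le> int (T (length w))"
    if w: "w \<in> lists (alphabet M)" and c: "(q, i, k) \<in> set_pmf (run M w t)" for w t q i k
  proof (cases "t \<le> T (length w)")
    case True
    then show ?thesis using counter_le_time[OF c] by linarith
  next
    case False
    then have "run M w t = run M w (T (length w))"
      using run_halted[of M w "T (length w)" "t - T (length w)"] T(1) w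
      by (auto simp: time_bounded_def)
    then show ?thesis using counter_le_time[of q i k M w "T (length w)"] c by simp
  qed
  then have "space_bounded M T"
    unfolding space_bounded_def by blast
  with T show ?thesis by (auto simp: linear_space_def)
qed

text \<open>Allows machines over any countable state type: \<open>to_nat\<close> is the renaming,
  and linear space follows from linear time.\<close>

lemma in_linear_2PCA_languagesI:
  fixes M :: "('q :: countable, nat) pca2"
  assumes "wf_pca2 M" "linear_time M" "bounded_error_recognizes M L"
  shows "L \<in> linear_2PCA_languages"
proof -
  let ?M = "relabel (to_nat :: 'q \<Rightarrow> nat) M"
  have "linear_time ?M" using assms by (simp add: linear_time_relabel)
  then show ?thesis
    using assms linear_time_imp_linear_space[of ?M]
    by (auto simp: linear_2PCA_languages_def wf_relabel recognizes_relabel intro!: exI[of _ ?M])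
qed

section \<open>One-pass machines\<close>

primrec scan ::
  "('s \<Rightarrow> 'a \<Rightarrow> bool \<Rightarrow> ('s \<times> counter_op) pmf) \<Rightarrow> 'a list \<Rightarrow> 's \<times> int \<Rightarrow> ('s \<times> int) pmf"
where
  "scan \<delta> [] c = return_pmf c"
| "scan \<delta> (a # w) c = bind_pmf (\<delta> (fst c) a (snd c = 0))
     (\<lambda>(s, d). scan \<delta> w (s, update_counter d (snd c)))"

lemma scan_append: "scan \<delta> (u @ v) c = bind_pmf (scan \<delta> u c) (scan \<delta> v)"
  by (induction u arbitrary: c)
    (auto simp: bind_return_pmf bind_assoc_pmf split_def)

datatype 's control = Start | Acc | Rej | Work 's

instance control :: (countable) countable
  by countable_datatype

text \<open>The first control state is drawn from \<open>init\<close> at the left end-marker,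
  \<open>\<delta>\<close> acts once on each letter, and \<open>fin\<close> decides at the right
  end-marker.\<close>

locale one_pass =
  fixes S :: "'s set" and A :: "'a set" and init :: "'s pmf"
    and \<delta> :: "'s \<Rightarrow> 'a \<Rightarrow> bool \<Rightarrow> ('s \<times> counter_op) pmf"
    and fin :: "'s \<Rightarrow> bool \<Rightarrow> bool"
  assumes finite_S: "finite S" and finite_A: "finite A"
    and init_S: "set_pmf init \<subseteq> S"
    and \<delta>_S: "\<And>s a z s' d. s \<in> S \<Longrightarrow> a \<in> A \<Longrightarrow> (s', d) \<in> set_pmf (\<delta> s a z) \<Longrightarrow> s' \<in> S"
begin

fun \<Delta> :: "'s control \<Rightarrow> 'a tape_symbol \<Rightarrow> bool \<Rightarrow> ('s control \<times> head_move \<times> counter_op) pmf" where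
  "\<Delta> Start LeftEnd z = map_pmf (\<lambda>s. (Work s, MoveRight, Keep)) init"
| "\<Delta> (Work s) (Input a) z = map_pmf (\<lambda>(s', d). (Work s', MoveRight, d)) (\<delta> s a z)"
| "\<Delta> (Work s) RightEnd z = return_pmf (if fin s z then Acc else Rej, Stay, Keep)"
| "\<Delta> _ _ z = return_pmf (Rej, Stay, Keep)"

definition machine :: "('s control, 'a) pca2" where
  "machine = \<lparr>states = {Start, Acc, Rej} \<union> Work ` S, alphabet = A, trans = \<Delta>,
     start = Start, accept = Acc, reject = Rej\<rparr>"

lemma machine_simps [simp]:
  "states machine = {Start, Acc, Rej} \<union> Work ` S" "alphabet machine = A" "trans machine = \<Delta>"
  "start machine = Start" "accept machine = Acc" "reject machine = Rej"
  by (simp_all add: machine_def)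

lemma wf_machine: "wf_pca2 machine"
proof -
  have "case x of (q', m, d) \<Rightarrow> q' \<in> states machine \<and> (a = LeftEnd \<longrightarrow> m \<noteq> MoveLeft) \<and>
      (a = RightEnd \<longrightarrow> m \<noteq> MoveRight)"
    if "q \<in> states machine" "a \<in> tape_symbols machine" "x \<in> set_pmf (trans machine q a z)"
    for q a z x
    using that init_S \<delta>_S
    by (cases "(q, a, z)" rule: \<Delta>.cases) (auto simp: tape_symbols_def)
  then have "\<forall>q \<in> states machine - {accept machine, reject machine}.
      \<forall>a \<in> tape_symbols machine. \<forall>z. \<forall>(q', m, d) \<in> set_pmf (trans machine q a z).
        q' \<in> states machine \<and> (a = LeftEnd \<longrightarrow> m \<noteq> MoveLeft) \<and> (a = RightEnd \<longrightarrow> m \<noteq> MoveRight)"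
    by blast
  then show ?thesis
    using finite_S finite_A unfolding wf_pca2_def by simp
qed

lemma not_halted [simp]: "\<not> halted machine (Start, i, k)" "\<not> halted machine (Work s, i, k)"
  by (simp_all add: halted_def)

definition outcome :: "'a list \<Rightarrow> ('s \<times> int) pmf" where
  "outcome w = bind_pmf init (\<lambda>s. scan \<delta> w (s, 0))"

text \<open>The first step only leaves the left end-marker, so \<open>Suc t\<close> steps read
  exactly \<open>t\<close> letters.\<close>

lemma run_scanning:
  assumes "t \<le> length w"
  shows "run machine w (Suc t) = map_pmf (\<lambda>(s, k). (Work s, Suc t, k)) (outcome (take t w))"
  using assms
proof (induction t)
  case 0
  show ?case
    by (simp add: bind_return_pmf step_def tape_def outcome_def pmf.map_comp o_def
        map_bind_pmf map_pmf_def[symmetric])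
next
  case (Suc t)
  have step: "step machine w (Work s, Suc t, k) =
      map_pmf (\<lambda>(s, k). (Work s, Suc (Suc t), k)) (scan \<delta> [w ! t] (s, k))" for s k
    using Suc.prems
    by (simp add: step_def tape_def pmf.map_comp o_def split_def map_pmf_def[symmetric])
  have "outcome (take (Suc t) w) = bind_pmf (outcome (take t w)) (scan \<delta> [w ! t])"
    using Suc.prems
    by (simp add: outcome_def take_Suc_conv_app_nth scan_append bind_assoc_pmf)
  then show ?case
    using Suc
    by (simp add: map_bind_pmf bind_map_pmf split_def step del: scan.simps)
qed

lemma run_finished:
  "run machine w (length w + 2) =
     map_pmf (\<lambda>(s, k). (if fin s (k = 0) then Acc else Rej, length w + 1, k)) (outcome w)"
proof -
  have "step machine w (Work s, Suc (length w), k) =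
      return_pmf (if fin s (k = 0) then Acc else Rej, length w + 1, k)" for s k
    by (simp add: step_def tape_def)
  moreover have "run machine w (length w + 2) =
      bind_pmf (map_pmf (\<lambda>(s, k). (Work s, Suc (length w), k)) (outcome w)) (step machine w)"
    using run_scanning[of "length w" w] by simp
  ultimately show ?thesis
    by (simp add: bind_map_pmf split_def map_pmf_def[symmetric] del: run.simps)
qed

lemma finished_halted: "\<forall>c \<in> set_pmf (run machine w (length w + 2)). halted machine c"
  unfolding run_finished by (auto simp: halted_def split: if_splits)

lemma linear_time_machine: "linear_time machine"
proof -
  have "(\<lambda>n. real (n + 2)) \<in> O(\<lambda>n. real n)"
    by (rule bigoI[of _ 3]) (auto intro!: eventually_at_top_linorderI[of 1])
  then show ?thesis
    using finished_halted unfolding linear_time_def time_bounded_def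
    by (intro exI[of _ "\<lambda>n. n + 2"]) auto
qed

text \<open>Nothing is accepted before step \<open>length w + 2\<close>, and everything has halted
  by then, so the supremum is attained at this step.\<close>

lemma accept_prob_machine:
  "accept_prob machine w = measure_pmf.prob (outcome w) {(s, k). fin s (k = 0)}"
proof -
  let ?P = "\<lambda>t. measure_pmf.prob (run machine w t) {c. fst c = accept machine}"
  have end_prob: "?P (length w + 2) = measure_pmf.prob (outcome w) {(s, k). fin s (k = 0)}"
    unfolding run_finished measure_map_pmf
    by (rule arg_cong[where f = "measure_pmf.prob _"]) (auto split: if_splits)
  have "?P t \<le> ?P (length w + 2)" for t
  proof -
    consider "t = 0" | t' where "t = Suc t'" "t' \<le> length w" | s where "t = length w + 2 + s"
      by (metis add_2_eq_Suc' le_Suc_ex not0_implies_Suc not_less_eq_eq)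
    then show ?thesis
    proof cases
      case 3
      then show ?thesis using run_halted[OF finished_halted[of w], of s] by simp
    next
      case 2
      then have "?P t = 0"
        by (auto simp: run_scanning measure_pmf_zero_iff simp del: run.simps)
      then show ?thesis by simp
    qed simp
  qed
  then have "accept_prob machine w = ?P (length w + 2)"
    unfolding accept_prob_def by (intro cSup_eq_maximum) blast+
  with end_prob show ?thesis by simp
qed

end

section \<open>Block words and the deterministic tests\<close>

text \<open>
  The letters 1, 2, 3 start a blank block, a block of digit 0 and a block of digit 1; the letter 0
  continues a block.  \<open>Rise\<close> counts the length of a block up and \<open>Fall r\<close> counts a fourth of the
  length of the next one down, \<open>r\<close> being that length modulo 4; \<open>Fresh\<close> runs this test from the second
  block on.  \<open>Zeros\<close> and \<open>Digits\<close> compare the numbers of blank and digit blocks.  \<open>Walk c sg\<close> is the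
  random walk inside a block started by \<open>c\<close>; since a machine only sees whether its counter is zero,
  \<open>sg\<close> remembers whether a nonzero counter is positive.
\<close>

datatype test = Fresh | Rise | Fall nat | Zeros | Digits | Walk nat bool | Fail

instance test :: countable
  by countable_datatype

fun det :: "test \<Rightarrow> nat \<Rightarrow> bool \<Rightarrow> test \<times> counter_op" where
  "det Fresh a z = (if a = 0 then Fail else Fall 0, Keep)"
| "det Rise a z = (if a = 0 then (Rise, Increment) else (Fall 1, Keep))"
| "det (Fall r) a z =
     (if a = 0 then if r = 3 then (Fall 0, Decrement) else (Fall (Suc r), Keep)
      else if r = 0 \<and> z then (Rise, Increment) else (Fail, Keep))"
| "det Zeros a z =
     (if a = 0 then (Zeros, Keep) else if a = 1 then (Zeros, Increment) else (Digits, Decrement))"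
| "det Digits a z =
     (if a = 0 then (Digits, Keep) else if a = 1 then (Fail, Keep) else (Digits, Decrement))"
| "det _ a z = (Fail, Keep)"

text \<open>Inside a digit block the counter moves by the toss (0 or 1) minus the digit. The flag
  \<open>sg\<close> is set anew only when the counter is zero before the step.\<close>

fun walk :: "nat \<Rightarrow> bool \<Rightarrow> nat \<Rightarrow> bool \<Rightarrow> bool \<Rightarrow> test \<times> counter_op" where
  "walk c sg a z b =
     (let c' = if a = 0 then c else a;
          d = if c' = 1 then Increment
              else if c' = 2 then if b then Increment else Keep
              else if b then Keep else Decrement
      in (Walk c' (if z then d = Increment else sg), d))"

fun tests :: "real \<Rightarrow> test \<Rightarrow> nat \<Rightarrow> bool \<Rightarrow> (test \<times> counter_op) pmf" where
  "tests p (Walk c sg) a z = map_pmf (walk c sg a z) (bernoulli_pmf p)"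
| "tests p s a z = return_pmf (det s a z)"

text \<open>\<open>Rise\<close> passes because the last block may lack a partner.
  \<open>Zeros\<close> fails because no digit block has been met.\<close>

fun passed :: "test \<Rightarrow> bool \<Rightarrow> bool" where
  "passed Rise z = True"
| "passed (Fall r) z = (r = 0 \<and> z)"
| "passed Digits z = z"
| "passed (Walk c sg) z = (\<not> z \<and> sg)"
| "passed _ z = False"

primrec drun :: "nat list \<Rightarrow> test \<Rightarrow> int \<Rightarrow> test \<times> int" where
  "drun [] s k = (s, k)"
| "drun (a # w) s k = (case det s a (k = 0) of (s', d) \<Rightarrow> drun w s' (update_counter d k))"

definition dpass :: "nat list \<Rightarrow> test \<Rightarrow> int \<Rightarrow> bool" where
  "dpass w s k = (case drun w s k of (s', k') \<Rightarrow> passed s' (k' = 0))"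

fun is_walk :: "test \<Rightarrow> bool" where
  "is_walk (Walk c sg) = True"
| "is_walk _ = False"

lemma scan_det:
  assumes "\<not> is_walk s"
  shows "scan (tests p) w (s, k) = return_pmf (drun w s k)"
  using assms
proof (induction w arbitrary: s k)
  case (Cons a w)
  have "\<not> is_walk (fst (det s a (k = 0)))"
    by (cases "(s, a, k = 0)" rule: det.cases) auto
  moreover have "tests p s a (k = 0) = return_pmf (det s a (k = 0))"
    using Cons.prems by (cases s) auto
  ultimately show ?case
    using Cons.IH by (auto simp: bind_return_pmf split_def)
qed simp

lemma dpass_Nil [simp]: "dpass [] s k = passed s (k = 0)"
  by (simp add: dpass_def)

lemma dpass_Cons [simp]:
  "dpass (a # w) s k =
     dpass w (fst (det s a (k = 0))) (update_counter (snd (det s a (k = 0))) k)"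
  by (simp add: dpass_def split_def)

lemma dpass_Fail [simp]: "\<not> dpass w Fail k"
  by (induction w arbitrary: k) auto

lemma dpass_Rise_zeros [simp]:
  "dpass (replicate n 0 @ v) Rise k = dpass v Rise (k + int n)"
  by (induction n arbitrary: k) (auto simp: algebra_simps)

lemma dpass_Zeros_zeros [simp]: "dpass (replicate n 0 @ v) Zeros k = dpass v Zeros k"
  by (induction n arbitrary: k) auto

lemma dpass_Digits_zeros [simp]: "dpass (replicate n 0 @ v) Digits k = dpass v Digits k"
  by (induction n arbitrary: k) auto

lemma dpass_Fall_zeros:
  assumes "r < 4"
  shows "dpass (replicate n 0 @ v) (Fall r) k =
    dpass v (Fall ((r + n) mod 4)) (k - int ((r + n) div 4))"
  using assms
proof (induction n arbitrary: r k)
  case (Suc n)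
  show ?case
  proof (cases "r = 3")
    case True
    then show ?thesis
      using Suc.IH[of 0] by (simp add: algebra_simps)
  next
    case False
    then show ?thesis
      using Suc.IH[of "Suc r"] Suc.prems by simp
  qed
qed simp

section \<open>Blocks and the ratio of their lengths\<close>

primrec blocks :: "(nat \<times> nat) list \<Rightarrow> nat list" where
  "blocks [] = []"
| "blocks (b # bs) = fst b # replicate (snd b) 0 @ blocks bs"

lemma block_decomposition:
  assumes "set w \<subseteq> {0..m}"
  obtains n bs where "w = replicate n 0 @ blocks bs" "fst ` set bs \<subseteq> {1..m}"
proof -
  have "\<exists>n bs. w = replicate n 0 @ blocks bs \<and> fst ` set bs \<subseteq> {1..m}"
    using assms
  proof (induction w)
    case Nil
    show ?case by (rule exI[of _ 0], rule exI[of _ "[]"]) simp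
  next
    case (Cons a w)
    then obtain n bs where IH: "w = replicate n 0 @ blocks bs" "fst ` set bs \<subseteq> {1..m}"
      by auto
    show ?case
    proof (cases "a = 0")
      case True
      with IH show ?thesis by (intro exI[of _ "Suc n"] exI[of _ bs]) simp
    next
      case False
      with IH Cons.prems show ?thesis
        by (intro exI[of _ 0] exI[of _ "(a, n) # bs"]) auto
    qed
  qed
  with that show thesis by blast
qed

text \<open>Blocks are grouped into disjoint pairs; as \<open>(c, n)\<close> stands for
  \<open>c\<close> followed by \<open>n\<close> zeros, the length of a block is
  \<open>Suc n\<close>.\<close>

fun paired :: "(nat \<times> nat) list \<Rightarrow> bool" where
  "paired (b # c # bs) \<longleftrightarrow> Suc (snd c) = 4 * Suc (snd b) \<and> paired bs"
| "paired _ \<longleftrightarrow> True"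

text \<open>The next block start and the end of the word impose the same condition on
  \<open>Fall r\<close>: complete quarters and an empty counter.\<close>

lemma dpass_Fall_blocks:
  assumes "0 \<notin> fst ` set bs"
  shows "dpass (blocks bs) (Fall r) k \<longleftrightarrow> r = 0 \<and> k = 0 \<and> dpass (blocks bs) (Fall 0) 0"
  using assms by (cases bs) auto

lemma dpass_paired:
  assumes "0 \<notin> fst ` set bs"
  shows "dpass (blocks bs) (Fall 0) 0 \<longleftrightarrow> paired bs"
  using assms
proof (induction bs rule: paired.induct)
  case (1 b c bs)
  have "dpass (blocks (b # c # bs)) (Fall 0) 0 \<longleftrightarrow>
      dpass (blocks bs) (Fall ((1 + snd c) mod 4)) (int (snd b) + 1 - int ((1 + snd c) div 4))"
    \<comment> \<open>The starting letter of each block is counted too: by \<open>Increment\<close>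
      on entering \<open>Rise\<close>, and by entering the second block in
      \<open>Fall 1\<close>.\<close>
    using "1.prems" by (simp add: dpass_Fall_zeros add.commute)
  also have "\<dots> \<longleftrightarrow> (1 + snd c) mod 4 = 0 \<and> int (snd b) + 1 - int ((1 + snd c) div 4) = 0 \<and>
      dpass (blocks bs) (Fall 0) 0"
    using "1.prems" by (subst dpass_Fall_blocks) auto
  also have "\<dots> \<longleftrightarrow> Suc (snd c) = 4 * Suc (snd b) \<and> paired bs"
    using 1 by auto
  finally show ?case by simp
next
  case ("2_2" b)
  then show ?case using dpass_Rise_zeros[of "snd b" "[]"] by simp
qed simp

primrec word :: "nat \<Rightarrow> nat list \<Rightarrow> nat list" where
  "word i [] = []"
| "word i (c # cs) = c # replicate (4 ^ i - 1) 0 @ word (Suc i) cs"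

text \<open>The two groupings into pairs together cover every two neighbours. In the induction they
  exchange their roles when the first block is dropped.\<close>

lemma paired_twice:
  assumes "paired (b # bs)" "paired bs" "Suc (snd b) = 4 ^ i"
  shows "blocks bs = word (Suc i) (map fst bs)"
  using assms
proof (induction bs arbitrary: b i)
  case (Cons c bs)
  then have "Suc (snd c) = 4 ^ Suc i" by simp
  moreover from this have "snd c = 4 ^ Suc i - 1" by linarith
  ultimately show ?case using Cons.IH[of c "Suc i"] Cons.prems by auto
qed simp

text \<open>The claim about the tail carries the induction: the pairs that start with a new first
  block are the first pair and the pairs of the tail of the rest.\<close>

lemma paired_word:
  "\<exists>bs. word i cs = blocks bs \<and> map fst bs = cs \<and> paired bs \<and>
     (bs \<noteq> [] \<longrightarrow> Suc (snd (hd bs)) = 4 ^ i \<and> paired (tl bs))"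
proof (induction cs arbitrary: i)
  case (Cons c cs)
  then obtain bs where bs: "word (Suc i) cs = blocks bs" "map fst bs = cs" "paired bs"
    "bs \<noteq> [] \<longrightarrow> Suc (snd (hd bs)) = 4 ^ Suc i \<and> paired (tl bs)" by meson
  then show ?case
    by (intro exI[of _ "(c, 4 ^ i - 1) # bs"]) (cases bs; auto)
qed simp

lemma Fresh_Fall_iff:
  assumes "set w \<subseteq> {0..m}"
  shows "dpass w Fresh 0 \<and> dpass w (Fall 0) 0 \<longleftrightarrow>
    (\<exists>cs. cs \<noteq> [] \<and> set cs \<subseteq> {1..m} \<and> w = word 0 cs)"
proof
  assume pass: "dpass w Fresh 0 \<and> dpass w (Fall 0) 0"
  obtain n bs where w: "w = replicate n 0 @ blocks bs" and bs: "fst ` set bs \<subseteq> {1..m}"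
    using block_decomposition[OF assms] by blast
  have n: "n = 0" using pass w by (cases n) auto
  obtain b bs' where bs_eq: "bs = b # bs'"
    using pass w n by (cases bs) auto
  have nz: "0 \<notin> fst ` set bs" using bs by auto
  have "dpass (replicate (snd b) 0 @ blocks bs') (Fall 0) 0"
    using pass w n bs_eq nz by auto
  \<comment> \<open>After the first letter \<open>Fresh\<close> has become \<open>Fall 0\<close>
    with an empty counter. Any further zero of the first block would leave a nonzero remainder or a
    negative counter, so this block has length 1.\<close>
  then have b: "snd b = 0" and "dpass (blocks bs') (Fall 0) 0"
    using nz bs_eq unfolding dpass_Fall_zeros[of 0, simplified]
    by (auto simp: dpass_Fall_blocks[of bs' "snd b mod 4"])
  then have "paired bs'" using dpass_paired nz bs_eq by auto
  moreover have "paired bs" using dpass_paired[OF nz] pass w n by simp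
  ultimately have "blocks bs' = word 1 (map fst bs')"
    using paired_twice[of b bs' 0] b bs_eq by simp
  then have "w = word 0 (map fst bs)"
    using w n bs_eq b by simp
  then show "\<exists>cs. cs \<noteq> [] \<and> set cs \<subseteq> {1..m} \<and> w = word 0 cs"
    using bs bs_eq by (intro exI[of _ "map fst bs"]) auto
next
  assume "\<exists>cs. cs \<noteq> [] \<and> set cs \<subseteq> {1..m} \<and> w = word 0 cs"
  then obtain cs where cs: "cs \<noteq> []" "set cs \<subseteq> {1..m}" "w = word 0 cs" by blast
  obtain bs where bs: "word 0 cs = blocks bs" "map fst bs = cs" "paired bs"
    "bs \<noteq> [] \<longrightarrow> Suc (snd (hd bs)) = 4 ^ 0 \<and> paired (tl bs)"
    using paired_word by blast
  then obtain b bs' where bs_eq: "bs = b # bs'" using cs by (cases bs) auto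
  have "0 \<notin> set (map fst bs)" using cs(2) bs(2) by auto
  then have nz: "0 \<notin> fst ` set bs" by simp
  have "dpass w (Fall 0) 0" using bs cs dpass_paired[OF nz] by simp
  moreover have "dpass w Fresh 0"
    using bs bs_eq cs nz dpass_paired[of bs'] by auto
  ultimately show "dpass w Fresh 0 \<and> dpass w (Fall 0) 0" by simp
qed

lemma dpass_Digits:
  assumes "0 \<notin> set cs"
  shows "dpass (word i cs) Digits k \<longleftrightarrow> 1 \<notin> set cs \<and> int (length cs) = k"
  using assms by (induction cs arbitrary: i k) auto

lemma dpass_Zeros:
  assumes "0 \<notin> set cs"
  shows "dpass (word i cs) Zeros k \<longleftrightarrow>
    (\<exists>j ds. cs = replicate j 1 @ ds \<and> 1 \<notin> set ds \<and> ds \<noteq> [] \<and> int (length ds) = k + int j)"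
  using assms
proof (induction cs arbitrary: i k)
  case (Cons c cs)
  \<comment> \<open>\<open>j = 0\<close> means that the first letter already carries a digit;
    \<open>Suc j\<close> means that it is one of the leading blanks.\<close>
  have ex_nat: "(\<exists>j. P j) \<longleftrightarrow> P 0 \<or> (\<exists>j. P (Suc j))" for P :: "nat \<Rightarrow> bool"
    by (metis not0_implies_Suc)
  show ?case
  proof (cases "c = 1")
    case True
    then show ?thesis
      using Cons by (subst ex_nat) (auto simp: algebra_simps)
  next
    case False
    then show ?thesis
      using Cons.prems by (subst ex_nat) (auto simp: dpass_Digits)
  qed
qed auto

section \<open>The random walk\<close>

primrec marks :: "nat \<Rightarrow> nat list \<Rightarrow> nat list" where
  "marks c [] = []"
| "marks c (a # w) = (let c' = if a = 0 then c else a in c' # marks c' w)"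

definition drift :: "real \<Rightarrow> nat \<Rightarrow> real" where
  "drift p c = (if c = 1 then 1 else if c = 2 then p else p - 1)"

definition spread :: "real \<Rightarrow> nat \<Rightarrow> real" where
  "spread p c = (if c = 1 then 0 else p * (1 - p))"

lemma scan_Walk_Cons:
  "scan (tests p) (a # w) (Walk c sg, k) = bind_pmf (bernoulli_pmf p)
     (\<lambda>b. case walk c sg a (k = 0) b of (s, d) \<Rightarrow> scan (tests p) w (s, update_counter d k))"
  by (simp add: bind_map_pmf)

lemma finite_scan_Walk: "finite (set_pmf (scan (tests p) w (Walk c sg, k)))"
proof (induction w arbitrary: c sg k)
  case (Cons a w)
  show ?case
    unfolding scan_Walk_Cons set_bind_pmf
    by (intro finite_UN_I finite) (simp add: Let_def Cons.IH)
qed simp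

text \<open>With steps of size at most one the sign can change only through zero, where
  \<open>sg\<close> is refreshed.\<close>

lemma scan_Walk_sign:
  assumes "(s, k') \<in> set_pmf (scan (tests p) w (Walk c sg, k))" "k \<noteq> 0 \<longrightarrow> sg = (k > 0)"
  shows "passed s (k' = 0) \<longleftrightarrow> k' > 0"
  using assms
proof (induction w arbitrary: c sg k)
  case (Cons a w)
  then obtain b where b: "(s, k') \<in> set_pmf (scan (tests p) w
      (fst (walk c sg a (k = 0) b), update_counter (snd (walk c sg a (k = 0) b)) k))"
    unfolding scan_Walk_Cons by (auto simp: split_def)
  show ?case
    by (rule Cons.IH[OF b[unfolded walk.simps Let_def fst_conv snd_conv]])
      (use Cons.prems(2) in auto)
qed auto

text \<open>The zero test affects only \<open>sg\<close>, so the increments are independent, with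
  means \<open>drift\<close> and variances \<open>spread\<close>. For \<open>x\<close> the mean end
  point, only the variance remains.\<close>

lemma second_moment:
  assumes "0 \<le> p" "p \<le> 1"
  shows "measure_pmf.expectation (scan (tests p) w (Walk c sg, k)) (\<lambda>(s, k'). (of_int k' - x)\<^sup>2) =
    (of_int k + sum_list (map (drift p) (marks c w)) - x)\<^sup>2 + sum_list (map (spread p) (marks c w))"
proof (induction w arbitrary: c sg k)
  case (Cons a w)
  let ?c = "if a = 0 then c else a"
  let ?m = "sum_list (map (drift p) (marks ?c w))" and ?v = "sum_list (map (spread p) (marks ?c w))"
  let ?d = "\<lambda>b. snd (walk c sg a (k = 0) b)"
  have "measure_pmf.expectation (scan (tests p) (a # w) (Walk c sg, k)) (\<lambda>(s, k'). (of_int k' - x)\<^sup>2) =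
      (\<Sum>b\<in>UNIV. pmf (bernoulli_pmf p) b *
        ((of_int (update_counter (?d b) k) + ?m - x)\<^sup>2 + ?v))"
    unfolding scan_Walk_Cons
    by (subst pmf_expectation_bind[of UNIV]) (auto simp: Let_def finite_scan_Walk Cons.IH)
  also have "\<dots> = (of_int k + (drift p ?c + ?m) - x)\<^sup>2 + (spread p ?c + ?v)"
    using assms
    by (auto simp: UNIV_bool Let_def drift_def spread_def) (simp_all add: power2_eq_square algebra_simps)
  finally show ?case by (simp add: Let_def)
qed simp

lemma chebyshev_Walk:
  assumes p: "0 \<le> p" "p \<le> 1" and g: "0 < g"
    and far: "\<And>k'. k' \<in> X \<Longrightarrow> g \<le> \<bar>of_int k' - sum_list (map (drift p) (marks c w))\<bar>"
  shows "measure_pmf.prob (scan (tests p) w (Walk c sg, 0)) {(s, k'). k' \<in> X} \<le>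
    sum_list (map (spread p) (marks c w)) / g\<^sup>2"
proof -
  let ?P = "scan (tests p) w (Walk c sg, 0)" and ?m = "sum_list (map (drift p) (marks c w))"
  have fin: "integrable (measure_pmf ?P) f" for f :: "test \<times> int \<Rightarrow> real"
    by (intro integrable_measure_pmf_finite finite_scan_Walk)
  have le: "indicator {(s, k'). k' \<in> X} y \<le> (case y of (s, k') \<Rightarrow> (of_int k' - ?m)\<^sup>2) / g\<^sup>2"
    for y :: "test \<times> int"
  proof (cases y)
    case (Pair s k')
    have "g\<^sup>2 \<le> (of_int k' - ?m)\<^sup>2" if "k' \<in> X"
      using far[OF that] g by (metis abs_le_square_iff abs_of_pos)
    then show ?thesis using g Pair by (auto simp: indicator_def)
  qed
  have "measure_pmf.prob ?P {(s, k'). k' \<in> X} =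
      measure_pmf.expectation ?P (indicator {(s, k'). k' \<in> X})"
    by simp
  also have "\<dots> \<le> measure_pmf.expectation ?P (\<lambda>y. (case y of (s, k') \<Rightarrow> (of_int k' - ?m)\<^sup>2) / g\<^sup>2)"
    by (intro integral_mono fin le)
  also have "\<dots> = measure_pmf.expectation ?P (\<lambda>(s, k'). (of_int k' - ?m)\<^sup>2) / g\<^sup>2"
    by simp
  also have "\<dots> = sum_list (map (spread p) (marks c w)) / g\<^sup>2"
    unfolding second_moment[OF p] by simp
  finally show ?thesis .
qed

section \<open>Mean and variance of the walk on block words\<close>

lemma marks_replicate: "marks c (replicate n 0 @ w) = replicate n c @ marks c w"
  by (induction n) auto

primrec weighted :: "(nat \<Rightarrow> real) \<Rightarrow> nat \<Rightarrow> nat list \<Rightarrow> real" where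
  "weighted f i [] = 0"
| "weighted f i (c # cs) = 4 ^ i * f c + weighted f (Suc i) cs"

lemma sum_marks_word:
  assumes "0 \<notin> set cs"
  shows "sum_list (map f (marks c (word i cs))) = weighted f i cs"
  using assms
proof (induction cs arbitrary: c i)
  case (Cons d cs)
  have "f d + real (4 ^ i - 1) * f d = 4 ^ i * f d"
    by (simp add: of_nat_diff algebra_simps)
  with Cons show ?case
    by (simp add: Let_def marks_replicate sum_list_replicate)
qed simp

lemma weighted_append:
  "weighted f i (cs @ ds) = weighted f i cs + weighted f (i + length cs) ds"
  by (induction cs arbitrary: i) auto

lemma weighted_replicate: "weighted f i (replicate n c) = (4 ^ (i + n) - 4 ^ i) / 3 * f c"
proof (induction n arbitrary: i)
  case (Suc n)
  then show ?case using Suc.IH[of "Suc i"] by (simp add: field_simps)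
qed simp

text \<open>Letters 2 and 3 stand for the base-4 digits 0 and 1, the least significant first, so
  that the weights match the growing block lengths.\<close>

primrec val :: "nat list \<Rightarrow> nat" where
  "val [] = 0"
| "val (d # ds) = d - 2 + 4 * val ds"

lemma weighted_drift:
  assumes "set ds \<subseteq> {2, 3}"
  shows "weighted (drift p) i ds = (4 ^ (i + length ds) - 4 ^ i) / 3 * p - 4 ^ i * real (val ds)"
  using assms
proof (induction ds arbitrary: i)
  case (Cons d ds)
  then have "d = 2 \<or> d = 3" by simp
  moreover have "weighted (drift p) (Suc i) ds =
      (4 ^ (Suc i + length ds) - 4 ^ Suc i) / 3 * p - 4 ^ Suc i * real (val ds)"
    using Cons by simp
  moreover have drift: "drift p 2 = p" "drift p 3 = p - 1"
    by (simp_all add: drift_def)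
  ultimately show ?case by (auto simp: drift field_simps)
qed simp

lemma weighted_spread:
  assumes "1 \<notin> set ds"
  shows "weighted (spread p) i ds = (4 ^ (i + length ds) - 4 ^ i) / 3 * (p * (1 - p))"
  using assms
proof (induction ds arbitrary: i)
  case (Cons d ds)
  then have "weighted (spread p) (Suc i) ds =
      (4 ^ (Suc i + length ds) - 4 ^ Suc i) / 3 * (p * (1 - p))"
    by simp
  moreover have spread: "spread p d = p * (1 - p)"
    using Cons.prems by (simp add: spread_def)
  ultimately show ?case by (simp add: spread field_simps)
qed simp

section \<open>The bias of the coin\<close>

text \<open>
  The first three digits vanish so that the bias of the coin is at most \<open>1 / 64\<close>, which keeps the
  variance of the walk small compared to its drift.
\<close>

primrec prefix_value :: "nat set \<Rightarrow> nat \<Rightarrow> nat" where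
  "prefix_value A 0 = 0"
| "prefix_value A (Suc j) = 4 * prefix_value A j + of_bool (3 \<le> j \<and> j - 3 \<in> A)"

text \<open>The factor 3 cancels the denominator of the geometric sum of the block lengths in the
  expected end point.\<close>

definition bias :: "nat set \<Rightarrow> real" where
  "bias A = 3 * (SUP j. real (prefix_value A j) / 4 ^ j)"

text \<open>Appending \<open>n\<close> digits from 0 and 1 adds at most
  \<open>(4 ^ n - 1) / 3\<close>; the second bound is this estimate without division.\<close>

lemma prefix_value_bounds:
  "4 ^ n * prefix_value A j \<le> prefix_value A (j + n)"
  "3 * prefix_value A (j + n) + 1 \<le> 4 ^ n * (3 * prefix_value A j + 1)"
  by (induction n) auto

lemma prefix_value_le:
  "real (prefix_value A i) / 4 ^ i \<le> (real (prefix_value A j) + 1 / 3) / 4 ^ j"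
proof (cases "i \<le> j")
  case True
  then obtain n where "j = i + n" by (auto dest: le_Suc_ex)
  moreover have "4 ^ n * real (prefix_value A i) \<le> real (prefix_value A (i + n))"
    using prefix_value_bounds(1)[of n A i] by (metis of_nat_le_iff of_nat_mult of_nat_numeral of_nat_power)
  ultimately show ?thesis by (simp add: field_simps power_add)
next
  case False
  then obtain n where "i = j + n" using le_Suc_ex[of j i] by auto
  moreover have "3 * real (prefix_value A (j + n)) + 1 \<le> 4 ^ n * (3 * real (prefix_value A j) + 1)"
    using of_nat_mono[OF prefix_value_bounds(2)[of A j n], where ?'a = real]
    by (simp add: algebra_simps)
  ultimately show ?thesis by (simp add: field_simps power_add)
qed

text \<open>The tail after \<open>j\<close> digits is worth at most 1/3 of a unit of the last one,
  which leaves a gap of 2/3 below the next integer.\<close>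

lemma bias_bounds:
  "real (prefix_value A j) \<le> 4 ^ j * bias A / 3"
  "4 ^ j * bias A / 3 \<le> real (prefix_value A j) + 1 / 3"
proof -
  let ?q = "\<lambda>j. real (prefix_value A j) / 4 ^ j"
  have "bdd_above (range ?q)"
    by (rule bdd_aboveI2[of _ _ "(real (prefix_value A j) + 1 / 3) / 4 ^ j"]) (rule prefix_value_le)
  then have "?q j \<le> (SUP j. ?q j)" by (intro cSUP_upper) auto
  then show "real (prefix_value A j) \<le> 4 ^ j * bias A / 3"
    by (simp add: bias_def field_simps)
  have "(SUP j. ?q j) \<le> (real (prefix_value A j) + 1 / 3) / 4 ^ j"
    by (intro cSUP_least prefix_value_le) auto
  then show "4 ^ j * bias A / 3 \<le> real (prefix_value A j) + 1 / 3"
    by (simp add: bias_def field_simps)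
qed

lemma bias_nonneg: "0 \<le> bias A"
  using bias_bounds(1)[of A 0] by simp

lemma bias_le: "bias A \<le> 1 / 64"
  \<comment> \<open>The prefix of length 3 is 0, hence \<open>64 * bias A / 3\<close> is at most
    1/3.\<close>
  using bias_bounds(2)[of 3 A] by (simp add: eval_nat_numeral)

definition language :: "nat set \<Rightarrow> nat list set" where
  "language A = {word 0 (replicate j 1 @ ds) | j ds.
     ds \<noteq> [] \<and> set ds \<subseteq> {2, 3} \<and> length ds = j \<and> val ds \<le> prefix_value A j}"

lemma walk_prob:
  fixes A :: "nat set"
  assumes ds: "ds \<noteq> []" "set ds \<subseteq> {2, 3}" and w: "w = word 0 (replicate (length ds) 1 @ ds)"
  defines "P \<equiv> scan (tests (bias A)) w (Walk 0 False, 0)"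
  defines "E \<equiv> {(s, k). passed s (k = 0)}"
  shows "val ds \<le> prefix_value A (length ds) \<Longrightarrow> measure_pmf.prob P E \<ge> 3 / 4"
    and "\<not> val ds \<le> prefix_value A (length ds) \<Longrightarrow> measure_pmf.prob P E \<le> 1 / 4"
proof -
  let ?p = "bias A" and ?j = "length ds" and ?Y = "real (prefix_value A (length ds))"
  let ?m = "sum_list (map (drift ?p) (marks 0 w))" and ?v = "sum_list (map (spread ?p) (marks 0 w))"
  let ?B = "4 ^ ?j :: real"
  have p: "0 \<le> ?p" "?p \<le> 1" "?p \<le> 1 / 64" using bias_nonneg[of A] bias_le[of A] by auto
  have nz: "0 \<notin> set (replicate ?j 1 @ ds)" "1 \<notin> set ds" using ds by auto
  have B: "4 \<le> ?B" using ds(1) by (cases ds) (auto intro: self_le_power)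
  \<comment> \<open>The blank blocks contribute \<open>(?B - 1) / 3\<close>; the digit blocks have
    total length \<open>(?B * ?B - ?B) / 3\<close> and contribute the rest.\<close>
  have m: "?m = (?B - 1) / 3 + ?B * (?B * ?p / 3) - ?B * ?p / 3 - ?B * real (val ds)"
    unfolding w sum_marks_word[OF nz(1)] weighted_append weighted_replicate weighted_drift[OF ds(2)]
    by (simp add: drift_def field_simps power_add)
  have "?v = (?B * ?B - ?B) / 3 * (?p * (1 - ?p))"
    unfolding w sum_marks_word[OF nz(1)] weighted_append weighted_replicate weighted_spread[OF nz(2)]
    by (simp add: spread_def power_add)
  also have "\<dots> \<le> (?B * ?B) / 3 * (1 / 64 * 1)"
    using p B by (intro mult_mono) auto
  \<comment> \<open>This compares \<open>?B * ?B / 192\<close> with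
    \<open>?B * ?B / 144\<close>.\<close>
  also have "\<dots> \<le> 1 / 4 * (?B / 6)\<^sup>2"
    by (simp add: power2_eq_square)
  finally have v: "?v / (?B / 6)\<^sup>2 \<le> 1 / 4"
    by (simp add: divide_simps)
  have E: "measure_pmf.prob P E = measure_pmf.prob P {(s, k). k \<in> {0<..}}"
    unfolding measure_Int_set_pmf[of P E, symmetric] measure_Int_set_pmf[of P "{(s, k). k \<in> {0<..}}", symmetric]
    by (rule arg_cong[where f = "measure_pmf.prob P"])
      (auto simp: E_def P_def dest: scan_Walk_sign)
  show "measure_pmf.prob P E \<ge> 3 / 4" if le: "val ds \<le> prefix_value A ?j"
  proof -
    \<comment> \<open>In case of equality the digit part may contribute almost nothing; the shift
      \<open>(?B - 1) / 3\<close>, at least \<open>?B / 4\<close>, then keeps the mean above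
      \<open>?B / 6\<close>.\<close>
    have "?B * real (val ds) \<le> ?B * (?B * ?p / 3)"
      using le bias_bounds(1)[of A ?j] by (intro mult_left_mono) auto
    moreover have "?B * ?p / 3 \<le> ?B / 192"
      using mult_left_mono[OF p(3), of ?B] by simp
    moreover have "b / 6 \<le> (b - 1) / 3 + x - y - v"
      if "v \<le> x" "y \<le> b / 192" "4 \<le> b" for b x y v :: real
      using that by (simp add: field_simps)
    ultimately have "?B / 6 \<le> ?m" unfolding m using B by blast
    then have "measure_pmf.prob P {(s, k). k \<in> {..0}} \<le> ?v / (?B / 6)\<^sup>2"
      unfolding P_def using p B by (intro chebyshev_Walk) auto
    moreover have "measure_pmf.prob P {(s, k). k \<in> {0<..}} =
        1 - measure_pmf.prob P {(s, k). k \<in> {..0}}"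
      by (subst measure_pmf.prob_compl[symmetric])
        (auto intro!: arg_cong[where f = "measure_pmf.prob P"])
    ultimately show ?thesis using v E by linarith
  qed
  show "measure_pmf.prob P E \<le> 1 / 4" if less: "\<not> val ds \<le> prefix_value A ?j"
  proof -
    \<comment> \<open>As integers, \<open>val ds\<close> exceeds the prefix by at least 1, and the
      tail of the bias recovers at most 1/3. The remaining \<open>- 2 * ?B / 3\<close> outweighs the
      shift.\<close>
    have "?B * (?B * ?p / 3) \<le> ?B * (real (val ds) - 2 / 3)"
      using less bias_bounds(2)[of ?j A] by (intro mult_left_mono) auto
    moreover have "0 \<le> ?B * ?p / 3" using p by simp
    moreover have "(b - 1) / 3 + x - y - b * v \<le> - (b / 6)"
      if "x \<le> b * (v - 2 / 3)" "0 \<le> y" "4 \<le> b" for b x y v :: real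
      using that by (simp add: field_simps)
    ultimately have "?m \<le> - (?B / 6)" unfolding m using B by blast
    then have "measure_pmf.prob P {(s, k). k \<in> {0<..}} \<le> ?v / (?B / 6)\<^sup>2"
      unfolding P_def using p B by (intro chebyshev_Walk) auto
    then show ?thesis using v E by linarith
  qed
qed

section \<open>Uncountably many languages\<close>

text \<open>Three of seven values lead to \<open>Fail\<close>: the cut 7/2 lies midway between 15/4
  and 13/4, the bounds on the expected number of passed tests for members and non-members.\<close>

definition choice :: "nat \<Rightarrow> test" where
  "choice n = (if n = 0 then Fresh else if n = 1 then Fall 0 else if n = 2 then Zeros
     else if n = 3 then Walk 0 False else Fail)"

definition controls :: "test set" where
  "controls = {Fresh, Rise, Zeros, Digits, Fail} \<union> Fall ` {..3} \<union> (\<Union>sg. (\<lambda>c. Walk c sg) ` {..3})"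

definition choice_pmf :: "test pmf" where
  "choice_pmf = map_pmf choice (pmf_of_set {..<7})"

lemma controls_simps [simp]:
  "Fresh \<in> controls" "Rise \<in> controls" "Zeros \<in> controls" "Digits \<in> controls" "Fail \<in> controls"
  "Fall r \<in> controls \<longleftrightarrow> r \<le> 3" "Walk c sg \<in> controls \<longleftrightarrow> c \<le> 3"
  by (auto simp: controls_def)

lemma one_pass_tests: "one_pass controls {..3} choice_pmf (tests p)"
proof
  show "finite controls" by (simp add: controls_def)
  show "set_pmf choice_pmf \<subseteq> controls"
    by (auto simp: choice_pmf_def choice_def)
  show "s' \<in> controls"
    if "s \<in> controls" "a \<in> {..3}" "(s', d) \<in> set_pmf (tests p s a z)" for s a z s' d
    using that by (cases s) (auto simp: Let_def split: if_splits)
qed simp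

interpretation one_pass controls "{..3}" choice_pmf "tests p" passed for p
  by (rule one_pass_tests)

lemma prob_det:
  assumes "\<not> is_walk s"
  shows "measure_pmf.prob (scan (tests p) w (s, 0)) {(s, k). passed s (k = 0)} = of_bool (dpass w s 0)"
  by (simp add: scan_det[OF assms] dpass_def indicator_def split_def)

section \<open>Acceptance probability of the combined machine\<close>

lemma accept_prob_tests:
  "accept_prob (machine p) w = (of_bool (dpass w Fresh 0) + of_bool (dpass w (Fall 0) 0) +
     of_bool (dpass w Zeros 0) +
     measure_pmf.prob (scan (tests p) w (Walk 0 False, 0)) {(s, k). passed s (k = 0)}) / 7"
proof -
  let ?E = "{(s, k). passed s (k = 0)}"
  let ?f = "\<lambda>n. scan (tests p) w (choice n, 0)"
  have fin: "finite (set_pmf (?f n))" for n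
    using finite_scan_Walk[of p w 0 False 0] by (auto simp: choice_def scan_det)
  have "accept_prob (machine p) w = measure_pmf.prob (pmf_of_set {..<7} \<bind> ?f) ?E"
    unfolding accept_prob_machine outcome_def
    unfolding choice_pmf_def bind_map_pmf ..
  also have "\<dots> = measure_pmf.expectation (pmf_of_set {..<7} \<bind> ?f) (indicator ?E)"
    by simp
  also have "\<dots> = (\<Sum>n<7. measure_pmf.prob (?f n) ?E) / 7"
    by (subst pmf_expectation_bind_pmf_of_set) (auto simp: fin sum_divide_distrib field_simps lessThan_empty_iff)
  also have "(\<Sum>n<7. measure_pmf.prob (?f n) ?E) = of_bool (dpass w Fresh 0) + of_bool (dpass w (Fall 0) 0) +
     of_bool (dpass w Zeros 0) + measure_pmf.prob (scan (tests p) w (Walk 0 False, 0)) ?E"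
    by (simp add: eval_nat_numeral choice_def prob_det)
  finally show ?thesis .
qed

lemma dpass_all_iff:
  assumes "set w \<subseteq> {0..3}"
  shows "dpass w Fresh 0 \<and> dpass w (Fall 0) 0 \<and> dpass w Zeros 0 \<longleftrightarrow>
    (\<exists>ds. ds \<noteq> [] \<and> set ds \<subseteq> {2, 3} \<and> w = word 0 (replicate (length ds) 1 @ ds))"
proof
  assume pass: "dpass w Fresh 0 \<and> dpass w (Fall 0) 0 \<and> dpass w Zeros 0"
  then obtain cs where cs: "set cs \<subseteq> {1..3}" "w = word 0 cs"
    using Fresh_Fall_iff[OF assms] by blast
  then obtain j ds where ds: "cs = replicate j 1 @ ds" "1 \<notin> set ds" "ds \<noteq> []" "length ds = j"
    using pass dpass_Zeros[of cs 0 0] by fastforce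
  have "d = 2 \<or> d = 3" if "d \<in> set ds" for d
  proof -
    have "d \<in> {1..3}" "d \<noteq> 1" using that ds cs(1) by auto
    then show ?thesis by auto
  qed
  then show "\<exists>ds. ds \<noteq> [] \<and> set ds \<subseteq> {2, 3} \<and> w = word 0 (replicate (length ds) 1 @ ds)"
    using ds cs by (intro exI[of _ ds]) auto
next
  assume "\<exists>ds. ds \<noteq> [] \<and> set ds \<subseteq> {2, 3} \<and> w = word 0 (replicate (length ds) 1 @ ds)"
  then obtain ds where ds: "ds \<noteq> []" "set ds \<subseteq> {2, 3}"
    and w: "w = word 0 (replicate (length ds) 1 @ ds)" by blast
  let ?cs = "replicate (length ds) 1 @ ds"
  have cs: "?cs \<noteq> []" "set ?cs \<subseteq> {1..3}" "0 \<notin> set ?cs" "1 \<notin> set ds" using ds by auto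
  have "dpass w Zeros 0"
    unfolding w dpass_Zeros[OF cs(3)] using cs ds by fastforce
  then show "dpass w Fresh 0 \<and> dpass w (Fall 0) 0 \<and> dpass w Zeros 0"
    using Fresh_Fall_iff[OF assms] cs w by blast
qed

lemma set_word: "set (word i cs) \<subseteq> insert 0 (set cs)"
  by (induction cs arbitrary: i) auto

lemma language_alphabet: "language A \<subseteq> lists {..3}"
proof
  fix w
  assume "w \<in> language A"
  then obtain j ds where "w = word 0 (replicate j 1 @ ds)" "set ds \<subseteq> {2, 3}"
    by (auto simp: language_def)
  then show "w \<in> lists {..3}"
    using set_word[of 0 "replicate j 1 @ ds"] by (fastforce simp: in_lists_conv_set)
qed

lemma accept_prob_language:
  "w \<in> language A \<Longrightarrow> accept_prob (machine (bias A)) w \<ge> 15 / 28"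
  "w \<in> lists {..3} - language A \<Longrightarrow> accept_prob (machine (bias A)) w \<le> 13 / 28"
proof -
  assume w: "w \<in> language A"
  then obtain ds where ds: "ds \<noteq> []" "set ds \<subseteq> {2, 3}" "w = word 0 (replicate (length ds) 1 @ ds)"
    "val ds \<le> prefix_value A (length ds)"
    by (auto simp: language_def)
  have "set w \<subseteq> {0..3}" using w language_alphabet[of A] by auto
  then have "dpass w Fresh 0 \<and> dpass w (Fall 0) 0 \<and> dpass w Zeros 0"
    using dpass_all_iff ds by blast
  then show "accept_prob (machine (bias A)) w \<ge> 15 / 28"
    using walk_prob(1)[OF ds(1-3), of A] ds(4) by (simp add: accept_prob_tests)
next
  assume w: "w \<in> lists {..3} - language A"
  then have set: "set w \<subseteq> {0..3}" by auto
  show "accept_prob (machine (bias A)) w \<le> 13 / 28"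
  proof (cases "dpass w Fresh 0 \<and> dpass w (Fall 0) 0 \<and> dpass w Zeros 0")
    case True
    then obtain ds where ds: "ds \<noteq> []" "set ds \<subseteq> {2, 3}" "w = word 0 (replicate (length ds) 1 @ ds)"
      using dpass_all_iff[OF set] by blast
    then have "\<not> val ds \<le> prefix_value A (length ds)"
      using w by (auto simp: language_def)
    then show ?thesis
      using walk_prob(2)[OF ds, of A] True by (simp add: accept_prob_tests)
  next
    case False
    then have "of_bool (dpass w Fresh 0) + of_bool (dpass w (Fall 0) 0) +
        of_bool (dpass w Zeros 0) \<le> (2 :: real)"
      by auto
    \<comment> \<open>Even if the walk always passes, the acceptance probability is at most 3/7 =
      12/28.\<close>
    then have "accept_prob (machine (bias A)) w \<le> (2 + 1) / 7"
      unfolding accept_prob_tests by (intro divide_right_mono add_mono) auto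
    then show ?thesis by simp
  qed
qed

lemma language_in_linear_2PCA_languages: "language A \<in> linear_2PCA_languages"
proof (rule in_linear_2PCA_languagesI[OF wf_machine linear_time_machine])
  have "recognizes_with_error (machine (bias A)) (13 / 28) (language A)"
    unfolding recognizes_with_error_def
    using accept_prob_language language_alphabet by auto
  then show "bounded_error_recognizes (machine (bias A)) (language A)"
    unfolding bounded_error_recognizes_def by (intro exI[of _ "13 / 28"]) auto
qed

section \<open>Different sets give different languages\<close>

primrec digits :: "nat set \<Rightarrow> nat \<Rightarrow> nat list" where
  "digits A 0 = []"
| "digits A (Suc j) = (2 + of_bool (3 \<le> j \<and> j - 3 \<in> A)) # digits A j"

lemma digits:
  "length (digits A j) = j" "set (digits A j) \<subseteq> {2, 3}" "val (digits A j) = prefix_value A j"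
  by (induction j) auto

lemma prefix_value_mono:
  assumes "language A \<subseteq> language B" "j > 0"
  shows "prefix_value A j \<le> prefix_value B j"
proof -
  \<comment> \<open>Deleting the zeros recovers the starting letters, so a word determines its
    blocks.\<close>
  have nonzero: "filter (\<lambda>a. a \<noteq> 0) (word i cs) = cs" if "0 \<notin> set cs" for i cs
    using that by (induction cs arbitrary: i) auto
  let ?w = "word 0 (replicate j 1 @ digits A j)"
  have "digits A j \<noteq> []" using assms(2) digits(1)[of A j] by auto
  then have "?w \<in> language A"
    unfolding language_def using digits[of A j]
    by (intro CollectI exI[of _ j] exI[of _ "digits A j"]) simp
  then obtain j' ds where ds: "?w = word 0 (replicate j' 1 @ ds)" "set ds \<subseteq> {2, 3}" "length ds = j'"
    "val ds \<le> prefix_value B j'"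
    using assms(1) unfolding language_def by blast
  have "replicate j 1 @ digits A j = replicate j' 1 @ ds"
    using arg_cong[OF ds(1), of "filter (\<lambda>a. a \<noteq> 0)"] ds(2) digits(2)[of A j]
    by (subst (asm) (1 2) nonzero) auto
  moreover from arg_cong[OF this, of length] have "j = j'"
    using digits(1)[of A j] ds(3) by simp
  ultimately show ?thesis using ds(4) digits(3)[of A j] by simp
qed

lemma inj_language: "inj language"
proof (rule injI)
  fix A B
  assume "language A = language B"
  then have eq: "prefix_value A j = prefix_value B j" for j
    by (cases "j = 0") (auto intro!: antisym prefix_value_mono)
  \<comment> \<open>Two consecutive prefixes determine the digit between them; the offset 3 skips
    the vanishing leading digits.\<close>
  have "n \<in> A \<longleftrightarrow> n \<in> B" for n
    using eq[of "Suc (n + 3)"] eq[of "n + 3"] unfolding prefix_value.simps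
    by (simp del: prefix_value.simps add: of_bool_eq_iff)
  then show "A = B" by blast
qed

theorem theorem3: "uncountable linear_2PCA_languages"
proof
  assume "countable linear_2PCA_languages"
  then have "countable (range language)"
    using language_in_linear_2PCA_languages by (auto intro: countable_subset)
  then have "countable (UNIV :: nat set set)"
    using inj_language by (rule countable_image_inj_on)
  then obtain f :: "nat \<Rightarrow> nat set" where "range f = UNIV"
    using uncountable_def[of "UNIV :: nat set set"] by auto
  then show False using Cantors_theorem[of UNIV] by (metis Pow_UNIV)
qed

end
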